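(* Let $K\ge2$. For $(\mathbf p,u)\in[0,1]^{K+1}$ define, with $\inf\varnothing=1$, $$F_{\mathrm{UG}}(\mathbf p,u)=\inf\left\{\alpha\in(0,1):\ \frac1K\sum_{k=1}^K\left(\log\frac\alpha{p_k}\right)_+\ge u\right\},\qquad F'_{\mathrm{UG}}(\mathbf p,u)=\inf\left\{\alpha\in(0,1):\ \frac1K\sum_{k=1}^K\log\frac\alpha{p_k}\ge u\right\},$$ and $F'_{\mathrm G}(\mathbf p)=e\,G(\mathbf p)$, seen as a randomized p-merging function whose value is not affected by $u$. The dominations among randomized p-merging functions $F_{\mathrm{UG}}\le F'_{\mathrm{UG}}\le F'_{\mathrm G}$ are strict. Moreover, $$F'_{\mathrm{UG}}(\mathbf p,u)=e^uG(\mathbf p),\qquad F_{\mathrm{UG}}(\mathbf p,u)=\bigwedge_{m=1}^K\left(e^{uK/m}G(\mathbf p_{(m)})\right).$$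
   Context: $\bigwedge$ denotes minimum; $x_+=\max(x,0)$; $\log(\alpha/0)=\infty$. $G(\mathbf q)=\left(\prod_{i=1}^nq_i\right)^{1/n}$ is the geometric mean of a vector $\mathbf q$ with $n$ components; $\mathbf p_{(m)}$ is the vector of the $m$ smallest elements of $\mathbf p$. Fix an atomless probability space (one supporting a random variable uniform on $[0,1]$); $\mathcal U$ is the set of random variables uniform on $[0,1]$, $\mathcal U^K$ the set of random vectors (arbitrary joint distribution) with all $K$ components in $\mathcal U$, and $\mathcal U^K\otimes\mathcal U$ the set of pairs $(\mathbf P,U)\in\mathcal U^K\times\mathcal U$ with $U$ independent of $\mathbf P$. A randomized p-merging function is an increasing (non-decreasing in each component) Borel function $F:[0,1]^{K+1}\to[0,1]$ with $\mathbb P(F(\mathbf P,U)\le\alpha)\le\alpha$ for all $\alpha\in(0,1)$ and all $(\mathbf P,U)\in\mathcal U^K\otimes\mathcal U$. A function $F$ dominates a function $F^\circ$ if $F\le F^\circ$ at every point, and the domination is strict if $F<F^\circ$ at at least one point.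
   Formalization: F'_G and both closed formulas are truncated at 1 (as stated, e^u G(p) and e G(p) can exceed 1), and the formula for F_UG is asserted only for u > 0, since at u = 0 the definition gives F_UG = 0 while the formula gives min p (e.g. p = (1/2,...,1/2)). *)

theory Defs
  imports "HOL-Probability.Probability"
begin

text \<open>
  The number of p-values is \<open>K = CARD('k)\<close>; a point \<open>(p, u)\<close> of the cube \<open>[0,1]^(K+1)\<close> is an
  element of \<open>(real ^ 'k) \<times> real\<close>.
\<close>

definition cube :: "((real ^ 'k) \<times> real) set" where
  "cube = {(p, u). (\<forall>k. p $ k \<in> {0..1}) \<and> u \<in> {0..1}}"

text \<open>
  Uniform random variables are taken to have all their values in \<open>[0,1]\<close> (rather than almost all
  of them), so that functions on the cube can be composed with them.
\<close>

definition unif_rvs :: "'w measure \<Rightarrow> ('w \<Rightarrow> real) set" where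
  "unif_rvs M = {U \<in> borel_measurable M.
     (\<forall>\<omega>\<in>space M. U \<omega> \<in> {0..1}) \<and> distr M borel U = uniform_measure lborel {0..1}}"

definition atomless_space :: "'w measure \<Rightarrow> bool" where
  "atomless_space M \<longleftrightarrow> prob_space M \<and> unif_rvs M \<noteq> {}"

definition unif_vecs :: "'w measure \<Rightarrow> ('w \<Rightarrow> real ^ 'k) set" where
  "unif_vecs M = {P. \<forall>k. (\<lambda>\<omega>. P \<omega> $ k) \<in> unif_rvs M}"

text \<open>
  Independence is spelled out through the generated sigma-algebras because
  \<open>indep_var\<close> requires both variables to have the same codomain type.
\<close>

definition unif_pairs :: "'w measure \<Rightarrow> (('w \<Rightarrow> real ^ 'k) \<times> ('w \<Rightarrow> real)) set" where
  "unif_pairs M = {(P, U). P \<in> unif_vecs M \<and> U \<in> unif_rvs M \<and>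
     prob_space.indep_set M
       {P -` A \<inter> space M | A. A \<in> sets borel} {U -` B \<inter> space M | B. B \<in> sets borel}}"

definition randomized_p_merging :: "'w measure \<Rightarrow> ((real ^ 'k) \<times> real \<Rightarrow> real) \<Rightarrow> bool" where
  "randomized_p_merging M F \<longleftrightarrow>
     (\<forall>x\<in>cube. F x \<in> {0..1}) \<and>
     (\<forall>p u p' u'. (p, u) \<in> cube \<longrightarrow> (p', u') \<in> cube \<longrightarrow> (\<forall>k. p $ k \<le> p' $ k) \<longrightarrow> u \<le> u' \<longrightarrow>
        F (p, u) \<le> F (p', u')) \<and>
     F \<in> borel_measurable (restrict_space borel cube) \<and>
     (\<forall>\<alpha>\<in>{0<..<1}. \<forall>(P, U)\<in>unif_pairs M.
        measure M {\<omega> \<in> space M. F (P \<omega>, U \<omega>) \<le> \<alpha>} \<le> \<alpha>)"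

definition dominates :: "((real ^ 'k) \<times> real \<Rightarrow> real) \<Rightarrow> ((real ^ 'k) \<times> real \<Rightarrow> real) \<Rightarrow> bool" where
  "dominates F F' \<longleftrightarrow> (\<forall>x\<in>cube. F x \<le> F' x)"

definition strictly_dominates ::
    "((real ^ 'k) \<times> real \<Rightarrow> real) \<Rightarrow> ((real ^ 'k) \<times> real \<Rightarrow> real) \<Rightarrow> bool" where
  "strictly_dominates F F' \<longleftrightarrow> dominates F F' \<and> (\<exists>x\<in>cube. F x < F' x)"

text \<open>The geometric mean of the vector \<open>q\<close> with index set \<open>I\<close>.\<close>

definition geo_mean :: "'i set \<Rightarrow> ('i \<Rightarrow> real) \<Rightarrow> real" where
  "geo_mean I q = root (card I) (\<Prod>i\<in>I. q i)"

text \<open>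
  \<open>order_stat p 0 \<le> order_stat p 1 \<le> \<dots>\<close> are the components of \<open>p\<close>, with multiplicity; the vector
  of the \<open>m\<close> smallest components is \<open>order_stat p\<close> on the index set \<open>{..<m}\<close>.
\<close>

definition order_stat :: "real ^ 'k \<Rightarrow> nat \<Rightarrow> real" where
  "order_stat p i = sorted_list_of_multiset (image_mset (\<lambda>k. p $ k) (mset_set UNIV)) ! i"

text \<open>The extended real \<open>log (\<alpha> / x)\<close>, with \<open>log (\<alpha> / 0) = \<infinity>\<close>.\<close>

definition log_ratio :: "real \<Rightarrow> real \<Rightarrow> ereal" where
  "log_ratio \<alpha> x = (if x = 0 then \<infinity> else ereal (ln (\<alpha> / x)))"

definition inf_or_one :: "real set \<Rightarrow> real" where
  "inf_or_one A = (if A = {} then 1 else Inf A)"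

text \<open>
  For \<open>u = 0\<close> the condition defining \<open>F_UG\<close> holds for all \<open>\<alpha>\<close>, so \<open>F_UG (p, 0) = 0\<close>; hence its closed
  formula, which gives the minimum of \<open>p\<close> at \<open>u = 0\<close>, can only hold for \<open>u > 0\<close>.
\<close>

definition F_UG :: "(real ^ 'k) \<times> real \<Rightarrow> real" where
  "F_UG = (\<lambda>(p, u). inf_or_one {\<alpha> \<in> {0<..<1}.
     ereal (1 / real CARD('k)) * (\<Sum>k\<in>UNIV. max (log_ratio \<alpha> (p $ k)) 0) \<ge> ereal u})"

definition F'_UG :: "(real ^ 'k) \<times> real \<Rightarrow> real" where
  "F'_UG = (\<lambda>(p, u). inf_or_one {\<alpha> \<in> {0<..<1}.
     ereal (1 / real CARD('k)) * (\<Sum>k\<in>UNIV. log_ratio \<alpha> (p $ k)) \<ge> ereal u})"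

text \<open>
  The value \<open>e G(p)\<close> can exceed 1; as a p-merging function, with values in \<open>[0,1]\<close>, it is truncated
  at 1.
\<close>

definition F'_G :: "(real ^ 'k) \<times> real \<Rightarrow> real" where
  "F'_G = (\<lambda>(p, u). min 1 (exp 1 * geo_mean UNIV (\<lambda>k. p $ k)))"

end

theory Submission
  imports Defs "HOL-Real_Asymp.Real_Asymp"
begin

text \<open>
  The condition on \<open>\<alpha>\<close> defining \<open>F_UG\<close> or \<open>F'_UG\<close> has the form \<open>c \<le> \<alpha>\<close>, where \<open>c\<close> is the closed
  formula: a sum of positive parts of logarithms is at least \<open>v > 0\<close> iff some partial sum over the
  \<open>m\<close> smallest components is, and a sum of \<open>m\<close> logarithms is compared with \<open>v\<close> through the geometric
  mean. Hence \<open>F_UG \<le> \<alpha>\<close> is the event that \<open>U\<close> lies below the average of \<open>(log (\<alpha> / P\<^sub>k))\<^sub>+\<close>. Given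
  \<open>P\<close>, its probability is at most this average, whose expectation is \<open>\<integral> log (\<alpha> / x) dx = \<alpha>\<close> over
  \<open>[0, \<alpha>]\<close> under any dependence between the components of \<open>P\<close>. The other two functions inherit
  validity because \<open>F_UG\<close> dominates them.
\<close>

section \<open>Sums of logarithms and geometric means\<close>

text \<open>For 0 < c < 1 the infimum is the minimum c; for c = 0 it is 0 and not attained; for c
  \<ge> 1 the set is empty. The convention inf \<emptyset> = 1 is thus what produces the truncation
  at 1.\<close>

lemma inf_or_one_atLeast:
  assumes "0 \<le> c" "S = {\<alpha> \<in> {0<..<1}. c \<le> \<alpha>}"
  shows "inf_or_one S = min 1 c"
proof (cases "c < 1")
  case True
  have "Inf S = c"
  proof (cases "c = 0")
    case True
    then have "S = {0<..<1}"
      using assms by auto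
    then show ?thesis
      using True by simp
  next
    case False
    then have "c \<in> S"
      using assms \<open>c < 1\<close> by auto
    then show ?thesis
      using assms(2) by (intro cInf_eq_minimum) auto
  qed
  \<comment> \<open>The midpoint of c and 1 shows that S is nonempty, so the default value 1 is not
    taken.\<close>
  moreover have "(c + 1) / 2 \<in> S"
    using assms True by auto
  ultimately show ?thesis
    using True by (auto simp: inf_or_one_def)
next
  case False
  then have "S = {}"
    using assms by auto
  then show ?thesis
    using False by (simp add: inf_or_one_def)
qed

text \<open>A level strictly between y and x would lie in (0,1) by the two bounds and separate them.
  Functions with values in [0,1] can therefore be compared through their sublevel sets.\<close>

lemma le_if_sublevels_subset:
  fixes x y :: real
  assumes "x \<le> 1" "0 \<le> y" "\<And>\<alpha>. \<alpha> \<in> {0<..<1} \<Longrightarrow> y \<le> \<alpha> \<Longrightarrow> x \<le> \<alpha>"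
  shows "x \<le> y"
proof (rule ccontr)
  assume "\<not> x \<le> y"
  then obtain \<alpha> where "y < \<alpha>" "\<alpha> < x"
    using dense[of y x] by auto
  with assms(1,2) assms(3)[of \<alpha>] show False
    by auto
qed

section \<open>Sums of extended logarithms\<close>

lemma ereal_inverse_times_ge_iff:
  fixes n u :: real and x :: ereal
  assumes "n > 0"
  shows "ereal (1 / n) * x \<ge> ereal u \<longleftrightarrow> x \<ge> ereal (u * n)"
  using assms by (cases x) (auto simp: field_simps)

lemma log_ratio_sum_pos:
  assumes "\<And>i. i \<in> I \<Longrightarrow> q i > 0" "\<alpha> > 0"
  shows "(\<Sum>i\<in>I. log_ratio \<alpha> (q i)) = ereal (\<Sum>i\<in>I. ln (\<alpha> / q i))"
proof -
  have "(\<Sum>i\<in>I. log_ratio \<alpha> (q i)) = (\<Sum>i\<in>I. ereal (ln (\<alpha> / q i)))"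
    using assms by (intro sum.cong refl) (force simp: log_ratio_def)
  then show ?thesis
    by simp
qed

text \<open>With m terms, all q i > 0, the sum is m ln \<alpha> - ln (\<Prod> q i); dividing by m
  and exponentiating turns the product into the geometric mean.\<close>

lemma log_ratio_sum_ge_iff:
  fixes q :: "'i \<Rightarrow> real"
  assumes I: "finite I" "I \<noteq> {}" and q: "\<And>i. i \<in> I \<Longrightarrow> q i \<ge> 0" and \<alpha>: "\<alpha> > 0"
  shows "(\<Sum>i\<in>I. log_ratio \<alpha> (q i)) \<ge> ereal v \<longleftrightarrow> exp (v / real (card I)) * geo_mean I q \<le> \<alpha>"
proof (cases "\<exists>i\<in>I. q i = 0")
  \<comment> \<open>A zero component makes both sides true: the sum is \<infinity>, since no summand
    is -\<infinity>, and the geometric mean is 0.\<close>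
  case True
  then have "geo_mean I q = 0"
    using I by (auto simp: geo_mean_def prod_zero)
  moreover have "(\<Sum>i\<in>I. log_ratio \<alpha> (q i)) = \<infinity>"
    using True I by (auto simp: sum_Pinfty log_ratio_def)
  ultimately show ?thesis
    using \<alpha> by simp
next
  case False
  then have pos: "\<And>i. i \<in> I \<Longrightarrow> q i > 0"
    using q by force
  define m where "m = card I"
  have m: "m > 0"
    using I by (simp add: m_def card_gt_0_iff)
  have P: "(\<Prod>i\<in>I. q i) > 0"
    using pos by (rule prod_pos)
  have "(\<Sum>i\<in>I. ln (\<alpha> / q i)) = (\<Sum>i\<in>I. ln \<alpha> - ln (q i))"
    using False \<alpha> by (intro sum.cong) (auto simp: ln_div)
  also have "\<dots> = real m * ln \<alpha> - (\<Sum>i\<in>I. ln (q i))"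
    by (simp add: sum_subtractf m_def)
  also have "(\<Sum>i\<in>I. ln (q i)) = ln (\<Prod>i\<in>I. q i)"
    using I False by (subst ln_prod) auto
  finally have s: "(\<Sum>i\<in>I. ln (\<alpha> / q i)) = real m * ln \<alpha> - ln (\<Prod>i\<in>I. q i)" .
  have g: "geo_mean I q > 0"
    using P m by (simp add: geo_mean_def m_def)
  have lng: "ln (geo_mean I q) = ln (\<Prod>i\<in>I. q i) / real m"
    using P m by (simp add: geo_mean_def m_def ln_root)
  have "exp (v / real m) * geo_mean I q \<le> \<alpha> \<longleftrightarrow> ln (exp (v / real m) * geo_mean I q) \<le> ln \<alpha>"
    using g \<alpha> by (subst ln_le_cancel_iff) auto
  also have "\<dots> \<longleftrightarrow> v / real m + ln (\<Prod>i\<in>I. q i) / real m \<le> ln \<alpha>"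
    using g by (subst ln_mult) (auto simp: lng)
  also have "\<dots> \<longleftrightarrow> v \<le> real m * ln \<alpha> - ln (\<Prod>i\<in>I. q i)"
    using m by (simp add: field_simps)
  finally show ?thesis
    using log_ratio_sum_pos[of I q \<alpha>] pos \<alpha> s by (simp add: m_def)
qed

text \<open>The terms with positive logarithm are those with q i < \<alpha>. As q is sorted they
  form an initial segment, whose plain sum equals the full sum of positive parts; every other
  partial sum is at most that.\<close>

lemma log_ratio_pos_part_sum_ge_iff:
  fixes q :: "nat \<Rightarrow> real"
  assumes mono: "\<And>i j. i \<le> j \<Longrightarrow> j < K \<Longrightarrow> q i \<le> q j"
    and q: "\<And>i. i < K \<Longrightarrow> q i \<ge> 0" and \<alpha>: "\<alpha> > 0" and v: "v > 0"
  shows "(\<Sum>i<K. max (log_ratio \<alpha> (q i)) 0) \<ge> ereal v \<longleftrightarrow>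
    (\<exists>m\<in>{1..K}. (\<Sum>i<m. log_ratio \<alpha> (q i)) \<ge> ereal v)"
proof
  assume *: "(\<Sum>i<K. max (log_ratio \<alpha> (q i)) 0) \<ge> ereal v"
  define m where "m = card {i. i < K \<and> q i < \<alpha>}"
  have "{i. i < K \<and> q i < \<alpha>} \<subseteq> {..<K}"
    by auto
  then have "m \<le> K" "finite {i. i < K \<and> q i < \<alpha>}"
    unfolding m_def using card_mono[of "{..<K}" "{i. i < K \<and> q i < \<alpha>}"]
    by (auto intro: finite_subset)
  \<comment> \<open>A downward closed set of indices is determined by its cardinality m.\<close>
  have iff: "q i < \<alpha> \<longleftrightarrow> i < m" if "i < K" for i
  proof
    assume "q i < \<alpha>"
    then have "{..i} \<subseteq> {i. i < K \<and> q i < \<alpha>}"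
      using that mono[of _ i] by force
    then have "card {..i} \<le> m"
      unfolding m_def by (intro card_mono) auto
    then show "i < m"
      by simp
  next
    assume "i < m"
    show "q i < \<alpha>"
    proof (rule ccontr)
      assume "\<not> q i < \<alpha>"
      have "{i. i < K \<and> q i < \<alpha>} \<subseteq> {..<i}"
      proof
        fix j assume "j \<in> {i. i < K \<and> q i < \<alpha>}"
        then show "j \<in> {..<i}"
          using mono[of i j] \<open>\<not> q i < \<alpha>\<close> by (cases "i \<le> j") auto
      qed
      then have "m \<le> card {..<i}"
        unfolding m_def by (intro card_mono) auto
      then show False
        using \<open>i < m\<close> by simp
    qed
  qed
  have "(\<Sum>i<K. max (log_ratio \<alpha> (q i)) 0) = (\<Sum>i<m. max (log_ratio \<alpha> (q i)) 0)"
  proof (rule sum.mono_neutral_right)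
    show "\<forall>i\<in>{..<K} - {..<m}. max (log_ratio \<alpha> (q i)) 0 = 0"
    proof
      fix i assume "i \<in> {..<K} - {..<m}"
      then have "q i \<ge> \<alpha>"
        using iff[of i] by auto
      then show "max (log_ratio \<alpha> (q i)) 0 = 0"
        using \<alpha> by (auto simp: log_ratio_def max_def)
    qed
  qed (use \<open>m \<le> K\<close> in auto)
  also have "\<dots> = (\<Sum>i<m. log_ratio \<alpha> (q i))"
  proof (rule sum.cong)
    fix i assume "i \<in> {..<m}"
    then have "q i < \<alpha>" "q i \<ge> 0"
      using iff[of i] q[of i] \<open>m \<le> K\<close> by auto
    then show "max (log_ratio \<alpha> (q i)) 0 = log_ratio \<alpha> (q i)"
      using \<alpha> by (auto simp: log_ratio_def max_def)
  qed simp
  finally have **: "(\<Sum>i<m. log_ratio \<alpha> (q i)) \<ge> ereal v"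
    using * by simp
  \<comment> \<open>Here v > 0 matters: the empty sum 0 cannot reach v.\<close>
  moreover have "m \<noteq> 0"
    using ** v by (cases "m = 0") auto
  ultimately show "\<exists>m\<in>{1..K}. (\<Sum>i<m. log_ratio \<alpha> (q i)) \<ge> ereal v"
    using \<open>m \<le> K\<close> by (intro bexI[of _ m]) auto
next
  assume "\<exists>m\<in>{1..K}. (\<Sum>i<m. log_ratio \<alpha> (q i)) \<ge> ereal v"
  then obtain m where m: "m \<le> K" "(\<Sum>i<m. log_ratio \<alpha> (q i)) \<ge> ereal v"
    by auto
  note m(2)
  also have "(\<Sum>i<m. log_ratio \<alpha> (q i)) \<le> (\<Sum>i<m. max (log_ratio \<alpha> (q i)) 0)"
    by (intro sum_mono) simp
  also have "\<dots> \<le> (\<Sum>i<K. max (log_ratio \<alpha> (q i)) 0)"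
    using m by (intro sum_mono2) auto
  finally show "(\<Sum>i<K. max (log_ratio \<alpha> (q i)) 0) \<ge> ereal v" .
qed

section \<open>Order statistics\<close>

text \<open>\<open>order_stat p\<close> indexes into a sorted list, and reading a list off by its
  indices returns its multiset. This transfers symmetric expressions and bounds between
  \<open>p\<close> and its sorted version.\<close>

lemma image_mset_order_stat:
  "image_mset (order_stat (p :: real ^ 'k::finite)) (mset_set {..<CARD('k)}) =
    image_mset (\<lambda>k. p $ k) (mset_set UNIV)"
proof -
  define xs where "xs = sorted_list_of_multiset (image_mset (\<lambda>k. p $ k) (mset_set UNIV))"
  have len: "length xs = CARD('k)"
    by (simp add: xs_def flip: size_mset)
  have "mset (map ((!) xs) [0..<length xs]) = mset xs"
    by (simp add: map_nth)
  then have "image_mset ((!) xs) (mset_set {..<length xs}) = mset xs"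
    by (simp add: atLeast0LessThan)
  moreover have "order_stat p = (!) xs"
    by (auto simp: order_stat_def xs_def)
  ultimately show ?thesis
    by (simp only: len) (simp add: xs_def)
qed

lemma order_stat_in_range:
  assumes "i < CARD('k)"
  shows "order_stat (p :: real ^ 'k::finite) i \<in> range (\<lambda>k. p $ k)"
proof -
  have "order_stat p i \<in># image_mset (order_stat p) (mset_set {..<CARD('k)})"
    using assms by auto
  then show ?thesis
    unfolding image_mset_order_stat by simp
qed

lemma order_stat_mono:
  assumes "i \<le> j" "j < CARD('k)"
  shows "order_stat (p :: real ^ 'k::finite) i \<le> order_stat p j"
proof -
  have "length (sorted_list_of_multiset (image_mset (\<lambda>k. p $ k) (mset_set UNIV))) = CARD('k)"
    by (simp flip: size_mset)
  then show ?thesis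
    using assms unfolding order_stat_def by (intro sorted_nth_mono) auto
qed

lemma sum_order_stat:
  "(\<Sum>i<CARD('k). f (order_stat (p :: real ^ 'k::finite) i)) = (\<Sum>k\<in>UNIV. f (p $ k))"
  using arg_cong[OF image_mset_order_stat[of p], of "\<lambda>A. sum_mset (image_mset f A)"]
  by (simp add: sum_unfold_sum_mset multiset.map_comp comp_def)

section \<open>Closed formulas and sublevel sets\<close>

definition UG_cond :: "real \<Rightarrow> (real ^ 'k) \<times> real \<Rightarrow> bool" where
  "UG_cond \<alpha> = (\<lambda>(p, u). ereal (1 / real CARD('k)) *
     (\<Sum>k\<in>UNIV. max (log_ratio \<alpha> (p $ k)) 0) \<ge> ereal u)"

text \<open>\<open>log_ratio_sum_ge_iff\<close> with v = u K and K terms: the factor K cancels in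
  the exponent, so the condition reads e^u G(p) \<le> \<alpha>.\<close>

lemma F'_UG_closed:
  fixes p :: "real ^ 'k::finite"
  assumes "(p, u) \<in> cube"
  shows "F'_UG (p, u) = min 1 (exp u * geo_mean UNIV (\<lambda>k. p $ k))"
  unfolding F'_UG_def prod.case
proof (rule inf_or_one_atLeast)
  have p: "\<And>k. p $ k \<ge> 0"
    using assms by (auto simp: cube_def)
  then show "0 \<le> exp u * geo_mean UNIV (\<lambda>k. p $ k)"
    by (simp add: geo_mean_def prod_nonneg)
  have "ereal u \<le> ereal (1 / real CARD('k)) * (\<Sum>k\<in>UNIV. log_ratio \<alpha> (p $ k)) \<longleftrightarrow>
      exp u * geo_mean UNIV (\<lambda>k. p $ k) \<le> \<alpha>" if "\<alpha> > 0" for \<alpha>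
    using that p by (simp add: ereal_inverse_times_ge_iff log_ratio_sum_ge_iff)
  then show "{\<alpha> \<in> {0<..<1}. ereal u \<le> ereal (1 / real CARD('k)) * (\<Sum>k\<in>UNIV. log_ratio \<alpha> (p $ k))}
      = {\<alpha> \<in> {0<..<1}. exp u * geo_mean UNIV (\<lambda>k. p $ k) \<le> \<alpha>}"
    by auto
qed

text \<open>The threshold from which \<open>UG_cond\<close> holds, before truncation at 1. At u = 0
  every positive level satisfies the condition, hence the separate value 0; the minimum would give
  the smallest component instead.\<close>

definition UG_level :: "(real ^ 'k) \<times> real \<Rightarrow> real" where
  "UG_level = (\<lambda>(p, u). if u = 0 then 0 else MIN m\<in>{1..CARD('k)}.
     exp (u * real CARD('k) / real m) * geo_mean {..<m} (order_stat p))"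

lemma UG_level_nonneg:
  fixes x :: "(real ^ 'k::finite) \<times> real"
  assumes "x \<in> cube"
  shows "0 \<le> UG_level x"
proof -
  obtain p u where x: "x = (p, u)"
    by (cases x)
  have "0 \<le> order_stat p i" if "i < CARD('k)" for i
    using order_stat_in_range[OF that, of p] assms by (auto simp: cube_def x)
  then have "0 \<le> geo_mean {..<m} (order_stat p)" if "m \<in> {1..CARD('k)}" for m
    using that by (auto simp: geo_mean_def intro!: prod_nonneg)
  then show ?thesis
    by (auto simp: x UG_level_def)
qed

text \<open>For u > 0, sort the components, replace positive parts by some partial sum of length m,
  and compare that sum with u K, which gives the exponent u K / m. For u = 0 both sides are
  true.\<close>

lemma UG_cond_iff:
  fixes x :: "(real ^ 'k::finite) \<times> real"
  assumes x: "x \<in> cube" and \<alpha>: "\<alpha> > 0"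
  shows "UG_cond \<alpha> x \<longleftrightarrow> UG_level x \<le> \<alpha>"
proof -
  obtain p u where pu: "x = (p, u)"
    by (cases x)
  show ?thesis
  proof (cases "u = 0")
    case True
    then show ?thesis
      using \<alpha> by (auto simp: pu UG_cond_def UG_level_def ereal_inverse_times_ge_iff
          simp flip: zero_ereal_def intro!: sum_nonneg)
  next
    case False
    with x have u: "u > 0"
      by (auto simp: pu cube_def)
    have q: "0 \<le> order_stat p i" if "i < CARD('k)" for i
      using order_stat_in_range[OF that, of p] x by (auto simp: cube_def pu)
    have "UG_cond \<alpha> x \<longleftrightarrow>
        (\<Sum>i<CARD('k). max (log_ratio \<alpha> (order_stat p i)) 0) \<ge> ereal (u * real CARD('k))"
      unfolding sum_order_stat[where f = "\<lambda>t. max (log_ratio \<alpha> t) 0"]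
      by (simp add: UG_cond_def pu ereal_inverse_times_ge_iff)
    also have "\<dots> \<longleftrightarrow> (\<exists>m\<in>{1..CARD('k)}.
        (\<Sum>i<m. log_ratio \<alpha> (order_stat p i)) \<ge> ereal (u * real CARD('k)))"
      using u \<alpha> q by (intro log_ratio_pos_part_sum_ge_iff order_stat_mono) auto
    also have "\<dots> \<longleftrightarrow> (\<exists>m\<in>{1..CARD('k)}.
        exp (u * real CARD('k) / real m) * geo_mean {..<m} (order_stat p) \<le> \<alpha>)"
    proof (rule bex_cong)
      fix m assume "m \<in> {1..CARD('k)}"
      then have "finite {..<m}" "{..<m} \<noteq> {}" "\<And>i. i \<in> {..<m} \<Longrightarrow> order_stat p i \<ge> 0"
        using q by (auto simp: lessThan_empty_iff)
      from log_ratio_sum_ge_iff[OF this \<alpha>]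
      show "(\<Sum>i<m. log_ratio \<alpha> (order_stat p i)) \<ge> ereal (u * real CARD('k)) \<longleftrightarrow>
          exp (u * real CARD('k) / real m) * geo_mean {..<m} (order_stat p) \<le> \<alpha>"
        by simp
    qed simp
    also have "\<dots> \<longleftrightarrow> UG_level x \<le> \<alpha>"
      using False by (simp add: pu UG_level_def Min_le_iff Bex_def)
    finally show ?thesis .
  qed
qed

lemma F_UG_eq_UG_level:
  fixes x :: "(real ^ 'k::finite) \<times> real"
  assumes "x \<in> cube"
  shows "F_UG x = min 1 (UG_level x)"
proof -
  obtain p u where pu: "x = (p, u)"
    by (cases x)
  have "F_UG x = inf_or_one {\<alpha> \<in> {0<..<1}. UG_cond \<alpha> x}"
    by (simp add: pu F_UG_def UG_cond_def)
  also have "\<dots> = min 1 (UG_level x)"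
    using assms by (intro inf_or_one_atLeast UG_level_nonneg) (auto simp: UG_cond_iff)
  finally show ?thesis .
qed

text \<open>As the admissible levels form a closed half-line within (0,1), the sublevel set at
  \<alpha> is the condition at \<alpha> itself, with no limit over larger levels; \<alpha> < 1 makes
  the truncation harmless.\<close>

lemma F_UG_le_iff:
  fixes x :: "(real ^ 'k::finite) \<times> real"
  assumes "x \<in> cube" "\<alpha> \<in> {0<..<1}"
  shows "F_UG x \<le> \<alpha> \<longleftrightarrow> UG_cond \<alpha> x"
  using assms by (auto simp: F_UG_eq_UG_level UG_cond_iff)

lemma F_UG_range:
  fixes x :: "(real ^ 'k::finite) \<times> real"
  assumes "x \<in> cube"
  shows "F_UG x \<in> {0..1}"
  using assms by (auto simp: F_UG_eq_UG_level UG_level_nonneg)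

lemma log_ratio_antimono:
  assumes "0 \<le> x" "x \<le> y" "0 < \<alpha>"
  shows "log_ratio \<alpha> y \<le> log_ratio \<alpha> x"
  using assms by (auto simp: log_ratio_def ln_div)

text \<open>Decreasing p raises each logarithm and decreasing u lowers the bound, so every level
  admissible for (p', u') is admissible for (p, u).\<close>

lemma F_UG_mono:
  fixes p p' :: "real ^ 'k::finite"
  assumes "(p, u) \<in> cube" "(p', u') \<in> cube" "\<forall>k. p $ k \<le> p' $ k" "u \<le> u'"
  shows "F_UG (p, u) \<le> F_UG (p', u')"
proof (rule le_if_sublevels_subset)
  fix \<alpha> :: real assume \<alpha>: "\<alpha> \<in> {0<..<1}" and "F_UG (p', u') \<le> \<alpha>"
  then have *: "ereal (u' * real CARD('k)) \<le> (\<Sum>k\<in>UNIV. max (log_ratio \<alpha> (p' $ k)) 0)"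
    using assms by (simp add: F_UG_le_iff UG_cond_def ereal_inverse_times_ge_iff)
  have "ereal (u * real CARD('k)) \<le> ereal (u' * real CARD('k))"
    using assms by (simp add: mult_right_mono)
  also note *
  also have "(\<Sum>k\<in>UNIV. max (log_ratio \<alpha> (p' $ k)) 0) \<le> (\<Sum>k\<in>UNIV. max (log_ratio \<alpha> (p $ k)) 0)"
    using assms \<alpha> by (intro sum_mono max.mono log_ratio_antimono) (auto simp: cube_def)
  finally show "F_UG (p, u) \<le> \<alpha>"
    using assms \<alpha> by (simp add: F_UG_le_iff UG_cond_def ereal_inverse_times_ge_iff)
qed (use F_UG_range[OF assms(1)] F_UG_range[OF assms(2)] in auto)

section \<open>Measurability of \<open>F_UG\<close>\<close>

lemma log_ratio_measurable [measurable]: "log_ratio \<alpha> \<in> borel_measurable borel"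
  unfolding log_ratio_def by measurable

lemma UG_cond_sets: "{x. UG_cond \<alpha> x} \<in> sets (borel :: ((real ^ 'k::finite) \<times> real) measure)"
proof -
  have [measurable]: "(\<lambda>x :: (real ^ 'k) \<times> real. fst x $ k) \<in> borel_measurable borel" for k
    by (intro borel_measurable_continuous_onI continuous_intros)
  have [measurable]: "(snd :: (real ^ 'k) \<times> real \<Rightarrow> real) \<in> borel_measurable borel"
    by (intro borel_measurable_continuous_onI continuous_intros)
  have "{x \<in> space (borel :: ((real ^ 'k) \<times> real) measure). ereal (1 / real CARD('k)) *
     (\<Sum>k\<in>UNIV. max (log_ratio \<alpha> (fst x $ k)) 0) \<ge> ereal (snd x)} \<in> sets borel"
    by measurable
  then show ?thesis
    by (simp add: UG_cond_def case_prod_unfold)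
qed

lemma cube_sets: "(cube :: ((real ^ 'k::finite) \<times> real) set) \<in> sets borel"
proof -
  have "closed ((\<Inter>k. {x :: (real ^ 'k) \<times> real. fst x $ k \<in> {0..1}}) \<inter> {x. snd x \<in> {0..1}})"
    unfolding atLeastAtMost_iff
    by (intro closed_Int closed_INT ballI closed_Collect_conj closed_Collect_le continuous_intros)
  also have "(\<Inter>k. {x :: (real ^ 'k) \<times> real. fst x $ k \<in> {0..1}}) \<inter> {x. snd x \<in> {0..1}} = cube"
    by (auto simp: cube_def)
  finally show ?thesis
    by (rule borel_closed)
qed

text \<open>For a \<le> 1 the set where \<open>F_UG\<close> < a is a countable union, over rational
  levels in (0,a), of the Borel sets given by \<open>UG_cond\<close>; for a > 1 it is the whole
  cube.\<close>

lemma F_UG_measurable: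
  "(F_UG :: (real ^ 'k::finite) \<times> real \<Rightarrow> real) \<in> borel_measurable (restrict_space borel cube)"
  unfolding borel_measurable_iff_less
proof
  fix a :: real
  let ?S = "{x :: (real ^ 'k) \<times> real. x \<in> cube \<and> F_UG x < a}"
  have "?S \<in> sets borel"
  proof (cases "a > 1")
    case True
    then have "?S = cube"
      using F_UG_range by (fastforce intro: le_less_trans)
    then show ?thesis
      by (simp add: cube_sets)
  next
    case False
    have "?S = (\<Union>\<alpha>\<in>\<rat> \<inter> {0<..<a}. {x. UG_cond \<alpha> x} \<inter> cube)"
    proof (intro set_eqI iffI)
      fix x :: "(real ^ 'k) \<times> real" assume x: "x \<in> ?S"
      then obtain \<alpha> where \<alpha>: "\<alpha> \<in> \<rat>" "F_UG x < \<alpha>" "\<alpha> < a"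
        using Rats_dense_in_real by blast
      moreover have "F_UG x \<ge> 0"
        using F_UG_range[of x] x by auto
      ultimately show "x \<in> (\<Union>\<alpha>\<in>\<rat> \<inter> {0<..<a}. {x. UG_cond \<alpha> x} \<inter> cube)"
        using F_UG_le_iff[of x \<alpha>] x False by auto
    next
      fix x :: "(real ^ 'k) \<times> real"
      assume "x \<in> (\<Union>\<alpha>\<in>\<rat> \<inter> {0<..<a}. {x. UG_cond \<alpha> x} \<inter> cube)"
      then obtain \<alpha> where "0 < \<alpha>" "\<alpha> < a" "UG_cond \<alpha> x" "x \<in> cube"
        by auto
      then show "x \<in> ?S"
        using F_UG_le_iff[of x \<alpha>] False by auto
    qed
    moreover have "(\<Union>\<alpha>\<in>\<rat> \<inter> {0<..<a}. {x :: (real ^ 'k) \<times> real. UG_cond \<alpha> x} \<inter> cube) \<in> sets borel"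
      using UG_cond_sets cube_sets
      by (intro sets.countable_UN'' sets.Int) (auto intro: countable_subset[OF _ countable_rat])
    ultimately show ?thesis
      by simp
  qed
  moreover have "{w \<in> space (restrict_space borel cube). F_UG w < a} = ?S"
    by (auto simp: space_restrict_space)
  ultimately show "{w \<in> space (restrict_space borel (cube :: ((real ^ 'k) \<times> real) set)). F_UG w < a}
      \<in> sets (restrict_space borel cube)"
    by (simp add: cube_sets sets_restrict_space_iff subset_iff)
qed

section \<open>Validity\<close>

lemma nn_integral_log_ratio:
  fixes \<alpha> :: real
  assumes \<alpha>: "0 < \<alpha>" "\<alpha> < 1"
  shows "(\<integral>\<^sup>+x. ennreal (max (ln (\<alpha> / x)) 0) \<partial>uniform_measure lborel {0..1}) = ennreal \<alpha>"
proof -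
  \<comment> \<open>An antiderivative of ln (\<alpha> / x) on x > 0, with limit 0 at 0 and value
    \<alpha> at \<alpha>.\<close>
  define F where "F = (\<lambda>x. x * ln (\<alpha> / x) + x)"
  have deriv: "(F has_real_derivative ln (\<alpha> / x)) (at x)" if "x > 0" for x
    unfolding F_def using that \<alpha> by (auto intro!: derivative_eq_intros simp: field_simps)
  have A: "((F \<circ> real_of_ereal) \<longlongrightarrow> 0) (at_right (ereal 0))"
    unfolding ereal_tendsto_simps F_def using \<alpha> by real_asymp
  have B: "((F \<circ> real_of_ereal) \<longlongrightarrow> F \<alpha>) (at_left (ereal \<alpha>))"
    unfolding ereal_tendsto_simps
    using DERIV_isCont[OF deriv[OF \<alpha>(1)]] by (simp add: isCont_def filterlim_at_split)
  have C: "isCont (\<lambda>x. ln (\<alpha> / x)) x" if "ereal 0 < ereal x" for x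
    using that \<alpha> by (intro continuous_intros) auto
  have D: "(F has_real_derivative ln (\<alpha> / x)) (at x)" if "ereal 0 < ereal x" for x
    using deriv that by simp
  have N: "AE x in lborel. ereal 0 < ereal x \<longrightarrow> ereal x < ereal \<alpha> \<longrightarrow> 0 \<le> ln (\<alpha> / x)"
    by (intro AE_I2) simp
  have lt: "ereal 0 < ereal \<alpha>"
    using \<alpha> by simp
  \<comment> \<open>For a nonnegative integrand the endpoint limits of \<open>F\<close> give
    integrability and the value together, despite the singularity at 0.\<close>
  note I = interval_integral_FTC_nonneg[OF lt D C N A B]
  have "(\<integral>\<^sup>+x. ennreal (max (ln (\<alpha> / x)) 0) \<partial>uniform_measure lborel {0..1})
      = (\<integral>\<^sup>+x. ennreal (max (ln (\<alpha> / x)) 0) * indicator {0..1} x \<partial>lborel)"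
    by (subst nn_integral_uniform_measure) (auto simp: divide_ennreal_def)
  also have "\<dots> = (\<integral>\<^sup>+x. ennreal (indicator {0<..<\<alpha>} x *\<^sub>R ln (\<alpha> / x)) \<partial>lborel)"
  proof (rule nn_integral_cong)
    fix x :: real
    \<comment> \<open>At x = 0 the integrand is 0, because \<alpha> / 0 = 0 and ln 0 = 0 for
      reals.\<close>
    consider "x \<le> 0" | "0 < x" "x < \<alpha>" | "x \<ge> \<alpha>"
      by linarith
    then show "ennreal (max (ln (\<alpha> / x)) 0) * indicator {0..1} x
        = ennreal (indicator {0<..<\<alpha>} x *\<^sub>R ln (\<alpha> / x))"
      using \<alpha> by cases (auto simp: max_def indicator_def)
  qed
  also have "\<dots> = ennreal (\<integral>x. indicator {0<..<\<alpha>} x *\<^sub>R ln (\<alpha> / x) \<partial>lborel)"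
    using I(1) by (intro nn_integral_eq_integral) (auto simp: set_integrable_def indicator_def)
  also have "(\<integral>x. indicator {0<..<\<alpha>} x *\<^sub>R ln (\<alpha> / x) \<partial>lborel) = \<alpha>"
    using I(2) \<alpha> by (simp add: interval_lebesgue_integral_def set_lebesgue_integral_def F_def)
  finally show ?thesis .
qed

section \<open>Joint laws under independence\<close>

text \<open>The product measure is determined by its values on rectangles, and there independence is
  exactly the product rule.\<close>

lemma (in prob_space) distr_pair_indep_set:
  fixes X :: "'a \<Rightarrow> 'b::second_countable_topology" and Y :: "'a \<Rightarrow> 'c::second_countable_topology"
  assumes [measurable]: "X \<in> borel_measurable M" "Y \<in> borel_measurable M"
    and indep: "indep_set {X -` A \<inter> space M | A. A \<in> sets borel} {Y -` B \<inter> space M | B. B \<in> sets borel}"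
  shows "distr M borel X \<Otimes>\<^sub>M distr M borel Y = distr M (borel \<Otimes>\<^sub>M borel) (\<lambda>\<omega>. (X \<omega>, Y \<omega>))"
proof (rule pair_measure_eqI)
  show "sigma_finite_measure (distr M borel X)" "sigma_finite_measure (distr M borel Y)"
    by (auto intro!: prob_space_imp_sigma_finite prob_space_distr)
  fix A B assume "A \<in> sets (distr M borel X)" "B \<in> sets (distr M borel Y)"
  then have [measurable]: "A \<in> sets borel" "B \<in> sets borel"
    by auto
  have "prob ((X -` A \<inter> space M) \<inter> (Y -` B \<inter> space M))
      = prob (X -` A \<inter> space M) * prob (Y -` B \<inter> space M)"
    by (rule indep_setD[OF indep]) auto
  moreover have "(\<lambda>\<omega>. (X \<omega>, Y \<omega>)) -` (A \<times> B) \<inter> space M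
      = (X -` A \<inter> space M) \<inter> (Y -` B \<inter> space M)"
    by auto
  ultimately show "emeasure (distr M borel X) A * emeasure (distr M borel Y) B
      = emeasure (distr M (borel \<Otimes>\<^sub>M borel) (\<lambda>\<omega>. (X \<omega>, Y \<omega>))) (A \<times> B)"
    by (simp add: emeasure_distr emeasure_eq_measure ennreal_mult')
qed (simp cong: sets_pair_measure_cong)

lemma unif_vecs_measurable:
  assumes "P \<in> unif_vecs M"
  shows "(P :: 'w \<Rightarrow> real ^ 'k::finite) \<in> borel_measurable M"
proof (rule borel_measurable_euclidean_space[THEN iffD2], rule ballI)
  fix b :: "real ^ 'k" assume "b \<in> Basis"
  then obtain k where "b = axis k 1"
    by (auto simp: Basis_vec_def)
  moreover have "(\<lambda>\<omega>. P \<omega> $ k) \<in> borel_measurable M"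
    using assms unfolding unif_vecs_def unif_rvs_def by blast
  ultimately show "(\<lambda>\<omega>. P \<omega> \<bullet> b) \<in> borel_measurable M"
    by (simp add: inner_axis)
qed

text \<open>By Fubini, condition on P = x: the uniform variable lies below g x with probability min
  1 (g x) \<le> g x. Equality may fail because g can exceed 1.\<close>

lemma (in prob_space) prob_unif_le_nn_integral:
  fixes P :: "'a \<Rightarrow> 'b::second_countable_topology"
  assumes [measurable]: "P \<in> borel_measurable M" "g \<in> borel_measurable borel"
    and U: "U \<in> unif_rvs M" and g: "\<And>x. 0 \<le> g x"
    and indep: "indep_set {P -` A \<inter> space M | A. A \<in> sets borel} {U -` B \<inter> space M | B. B \<in> sets borel}"
  shows "emeasure M {\<omega> \<in> space M. U \<omega> \<le> g (P \<omega>)} \<le> (\<integral>\<^sup>+\<omega>. ennreal (g (P \<omega>)) \<partial>M)"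
proof -
  have [measurable]: "U \<in> borel_measurable M" and dU: "distr M borel U = uniform_measure lborel {0..1}"
    using U by (auto simp: unif_rvs_def)
  interpret U: prob_space "distr M borel U"
    by (rule prob_space_distr) simp
  define S where "S = {x \<in> space (borel \<Otimes>\<^sub>M borel). snd x \<le> g (fst x)}"
  have S: "S \<in> sets (borel \<Otimes>\<^sub>M borel)"
    unfolding S_def by measurable
  have "emeasure M {\<omega> \<in> space M. U \<omega> \<le> g (P \<omega>)}
      = emeasure (distr M (borel \<Otimes>\<^sub>M borel) (\<lambda>\<omega>. (P \<omega>, U \<omega>))) S"
    by (subst emeasure_distr) (use S in \<open>auto intro!: arg_cong[of _ _ "emeasure M"] simp: S_def space_pair_measure\<close>)
  also have "\<dots> = emeasure (distr M borel P \<Otimes>\<^sub>M distr M borel U) S"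
    by (subst distr_pair_indep_set) (use indep in auto)
  also have "\<dots> = (\<integral>\<^sup>+x. emeasure (distr M borel U) (Pair x -` S) \<partial>distr M borel P)"
    by (rule U.emeasure_pair_measure_alt) (use S in \<open>simp only: sets_pair_measure_cong[OF sets_distr sets_distr]\<close>)
  also have "\<dots> \<le> (\<integral>\<^sup>+x. ennreal (g x) \<partial>distr M borel P)"
  proof (rule nn_integral_mono)
    fix x
    have "Pair x -` S = {..g x}"
      by (auto simp: S_def space_pair_measure)
    moreover have "emeasure lborel ({0..1} \<inter> {..g x}) \<le> emeasure lborel {0..g x}"
      by (rule emeasure_mono) auto
    ultimately show "emeasure (distr M borel U) (Pair x -` S)
        \<le> ennreal (g x)"
      using g[of x] by (simp add: dU divide_ennreal_def)
  qed
  also have "\<dots> = (\<integral>\<^sup>+\<omega>. ennreal (g (P \<omega>)) \<partial>M)"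
    by (rule nn_integral_distr) auto
  finally show ?thesis .
qed

section \<open>Validity of \<open>F_UG\<close> and of the functions it dominates\<close>

text \<open>\<open>prob_unif_le_nn_integral\<close> is applied to the average of the positive parts.
  Its expectation involves only the uniform marginals of \<open>P\<close>, so the joint law is
  arbitrary.\<close>

lemma F_UG_valid:
  fixes P :: "'w \<Rightarrow> real ^ 'k::finite"
  assumes M: "prob_space M" and PU: "(P, U) \<in> unif_pairs M" and \<alpha>: "\<alpha> \<in> {0<..<1}"
  shows "measure M {\<omega> \<in> space M. F_UG (P \<omega>, U \<omega>) \<le> \<alpha>} \<le> \<alpha>"
proof -
  interpret prob_space M by fact
  have P: "P \<in> unif_vecs M" and U: "U \<in> unif_rvs M"
    and indep: "indep_set {P -` A \<inter> space M | A. A \<in> sets borel} {U -` B \<inter> space M | B. B \<in> sets borel}"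
    using PU by (auto simp: unif_pairs_def)
  have Pk [measurable]: "(\<lambda>\<omega>. P \<omega> $ k) \<in> borel_measurable M"
    and dP: "distr M borel (\<lambda>\<omega>. P \<omega> $ k) = uniform_measure lborel {0..1}" for k
    using P by (auto simp: unif_vecs_def unif_rvs_def)
  have [measurable]: "P \<in> borel_measurable M" "U \<in> borel_measurable M"
    using unif_vecs_measurable[OF P] U by (auto simp: unif_rvs_def)
  have cube: "(P \<omega>, U \<omega>) \<in> cube" if "\<omega> \<in> space M" for \<omega>
    using that P U by (auto simp: cube_def unif_vecs_def unif_rvs_def)
  have [measurable]: "(\<lambda>x :: real ^ 'k. x $ k) \<in> borel_measurable borel" for k
    by (intro borel_measurable_continuous_onI continuous_intros)
  define g where "g = (\<lambda>p :: real ^ 'k. (\<Sum>k\<in>UNIV. max (ln (\<alpha> / p $ k)) 0) / real CARD('k))"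
  have [measurable]: "g \<in> borel_measurable borel"
    unfolding g_def by measurable
  \<comment> \<open>The real-valued \<open>g\<close> differs from the extended average only where
    some component is 0: there \<open>ln\<close> gives 0 and \<open>log_ratio\<close> gives
    \<infinity>. This is a null event.\<close>
  have nz: "AE \<omega> in M. P \<omega> $ k \<noteq> 0" for k
  proof -
    have "AE x in distr M borel (\<lambda>\<omega>. P \<omega> $ k). x \<noteq> 0"
      unfolding dP by (rule AE_uniform_measureI) (auto intro: AE_mp[OF AE_lborel_singleton])
    then show ?thesis
      by (subst (asm) AE_distr_iff) auto
  qed
  have "AE \<omega> in M. \<forall>k\<in>UNIV. P \<omega> $ k \<noteq> 0"
    using nz by (intro AE_finite_allI) auto
  then have "AE \<omega> in M. F_UG (P \<omega>, U \<omega>) \<le> \<alpha> \<longrightarrow> U \<omega> \<le> g (P \<omega>)"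
  proof (rule AE_mp[OF _ AE_I2], intro impI)
    fix \<omega> assume \<omega>: "\<omega> \<in> space M" "\<forall>k\<in>UNIV. P \<omega> $ k \<noteq> 0" "F_UG (P \<omega>, U \<omega>) \<le> \<alpha>"
    have "(\<Sum>k\<in>UNIV. max (log_ratio \<alpha> (P \<omega> $ k)) 0) = ereal (\<Sum>k\<in>UNIV. max (ln (\<alpha> / P \<omega> $ k)) 0)"
      unfolding sum_ereal[symmetric]
      using \<omega>(2) by (intro sum.cong) (auto simp: log_ratio_def max_def)
    then show "U \<omega> \<le> g (P \<omega>)"
      using \<omega> F_UG_le_iff[OF cube \<alpha>] by (simp add: UG_cond_def g_def)
  qed
  then have "measure M {\<omega> \<in> space M. F_UG (P \<omega>, U \<omega>) \<le> \<alpha>} \<le> measure M {\<omega> \<in> space M. U \<omega> \<le> g (P \<omega>)}"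
    by (intro finite_measure_mono_AE) auto
  also have "\<dots> \<le> \<alpha>"
  proof -
    have "ennreal (measure M {\<omega> \<in> space M. U \<omega> \<le> g (P \<omega>)}) \<le> (\<integral>\<^sup>+\<omega>. ennreal (g (P \<omega>)) \<partial>M)"
      unfolding emeasure_eq_measure[symmetric]
      by (rule prob_unif_le_nn_integral) (use U indep in \<open>auto simp: g_def intro!: sum_nonneg divide_nonneg_nonneg\<close>)
    also have "\<dots> = (\<integral>\<^sup>+\<omega>. (\<Sum>k\<in>UNIV. ennreal (max (ln (\<alpha> / P \<omega> $ k)) 0)) / ennreal (real CARD('k)) \<partial>M)"
      unfolding g_def by (intro nn_integral_cong)
        (simp add: divide_ennreal[symmetric] sum_nonneg sum_ennreal[symmetric] del: sum_ennreal)
    also have "\<dots> = (\<Sum>k\<in>UNIV. \<integral>\<^sup>+\<omega>. ennreal (max (ln (\<alpha> / P \<omega> $ k)) 0) \<partial>M) / ennreal (real CARD('k))"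
      by (subst nn_integral_divide) (auto simp: nn_integral_sum)
    also have "(\<integral>\<^sup>+\<omega>. ennreal (max (ln (\<alpha> / P \<omega> $ k)) 0) \<partial>M) = ennreal \<alpha>" for k
      using nn_integral_distr[OF Pk[of k], of "\<lambda>x. ennreal (max (ln (\<alpha> / x)) 0)"]
        nn_integral_log_ratio[of \<alpha>] \<alpha> by (simp add: dP)
    then have "(\<Sum>k\<in>UNIV. \<integral>\<^sup>+\<omega>. ennreal (max (ln (\<alpha> / P \<omega> $ k)) 0) \<partial>M) / ennreal (real CARD('k)) = ennreal \<alpha>"
      using \<alpha> by (simp add: ennreal_of_nat_eq_real_of_nat ennreal_mult'[symmetric] divide_ennreal)
    finally show ?thesis
      using \<alpha> by simp
  qed
  finally show ?thesis .
qed

lemma randomized_p_merging_F_UG: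
  assumes "prob_space M"
  shows "randomized_p_merging M (F_UG :: (real ^ 'k::finite) \<times> real \<Rightarrow> real)"
  unfolding randomized_p_merging_def
  using F_UG_range F_UG_mono F_UG_measurable F_UG_valid[OF assms] by blast

text \<open>Validity passes to larger functions: F \<le> F' puts the event F' \<le> \<alpha> inside
  the event F \<le> \<alpha>.\<close>

lemma randomized_p_merging_dominated:
  fixes F F' :: "(real ^ 'k::finite) \<times> real \<Rightarrow> real"
  assumes M: "prob_space M" and F: "randomized_p_merging M F" and dom: "dominates F F'"
    and range: "\<And>x. x \<in> cube \<Longrightarrow> F' x \<in> {0..1}"
    and mono: "\<And>p u p' u'. (p, u) \<in> cube \<Longrightarrow> (p', u') \<in> cube \<Longrightarrow> (\<And>k. p $ k \<le> p' $ k) \<Longrightarrow> u \<le> u' \<Longrightarrow>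
      F' (p, u) \<le> F' (p', u')"
    and meas: "F' \<in> borel_measurable (restrict_space borel cube)"
  shows "randomized_p_merging M F'"
proof -
  interpret prob_space M by fact
  have "measure M {\<omega> \<in> space M. F' (P \<omega>, U \<omega>) \<le> \<alpha>} \<le> \<alpha>"
    if \<alpha>: "\<alpha> \<in> {0<..<1}" and PU: "(P, U) \<in> unif_pairs M" for \<alpha> P U
  proof -
    have P: "P \<in> unif_vecs M" and U: "U \<in> unif_rvs M"
      using PU by (auto simp: unif_pairs_def)
    have cube: "(P \<omega>, U \<omega>) \<in> cube" if "\<omega> \<in> space M" for \<omega>
      using that P U by (auto simp: cube_def unif_vecs_def unif_rvs_def)
    have "(\<lambda>\<omega>. (P \<omega>, U \<omega>)) \<in> M \<rightarrow>\<^sub>M restrict_space borel cube"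
      using unif_vecs_measurable[OF P] U cube
      by (intro measurable_restrict_space2 borel_measurable_Pair) (auto simp: unif_rvs_def)
    moreover have "F \<in> borel_measurable (restrict_space borel cube)"
      using F by (auto simp: randomized_p_merging_def)
    \<comment> \<open>Monotonicity of \<open>measure\<close> requires the larger event, F \<le>
      \<alpha>, to be measurable.\<close>
    ultimately have [measurable]: "(\<lambda>\<omega>. F (P \<omega>, U \<omega>)) \<in> borel_measurable M"
      using measurable_compose by blast
    have "measure M {\<omega> \<in> space M. F' (P \<omega>, U \<omega>) \<le> \<alpha>} \<le> measure M {\<omega> \<in> space M. F (P \<omega>, U \<omega>) \<le> \<alpha>}"
      using dom cube by (intro finite_measure_mono) (force simp: dominates_def)+
    also have "\<dots> \<le> \<alpha>"
      using F \<alpha> PU by (auto simp: randomized_p_merging_def)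
    finally show ?thesis .
  qed
  then show ?thesis
    unfolding randomized_p_merging_def using range mono meas by blast
qed

section \<open>Dominations\<close>

lemma geo_mean_mono:
  assumes "\<And>i. i \<in> I \<Longrightarrow> 0 \<le> p i" "\<And>i. i \<in> I \<Longrightarrow> p i \<le> q i"
  shows "geo_mean I p \<le> geo_mean I q"
proof (cases "card I = 0")
  case False
  then show ?thesis
    using assms unfolding geo_mean_def by (intro real_root_le_mono prod_mono) auto
qed (simp add: geo_mean_def)

lemma geo_mean_nonneg:
  assumes "\<And>i. i \<in> I \<Longrightarrow> 0 \<le> p i"
  shows "0 \<le> geo_mean I p"
  unfolding geo_mean_def using assms by (intro real_root_ge_zero prod_nonneg) auto

text \<open>Replacing negative logarithms by 0 increases the sum, so more levels become
  admissible.\<close>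

lemma dominates_F_UG_F'_UG: "dominates (F_UG :: (real ^ 'k::finite) \<times> real \<Rightarrow> real) F'_UG"
  unfolding dominates_def
proof
  fix x :: "(real ^ 'k) \<times> real" assume x: "x \<in> cube"
  obtain p u where pu: "x = (p, u)"
    by (cases x)
  have p: "\<And>k. 0 \<le> p $ k"
    using x by (auto simp: pu cube_def)
  have F': "F'_UG x = min 1 (exp u * geo_mean UNIV (\<lambda>k. p $ k))"
    using F'_UG_closed x by (simp add: pu)
  show "F_UG x \<le> F'_UG x"
  proof (rule le_if_sublevels_subset)
    fix \<alpha> :: real assume \<alpha>: "\<alpha> \<in> {0<..<1}" "F'_UG x \<le> \<alpha>"
    then have "exp u * geo_mean UNIV (\<lambda>k. p $ k) \<le> \<alpha>"
      by (auto simp: F')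
    then have "ereal (u * real CARD('k)) \<le> (\<Sum>k\<in>UNIV. log_ratio \<alpha> (p $ k))"
      using log_ratio_sum_ge_iff[of UNIV "\<lambda>k. p $ k" \<alpha> "u * real CARD('k)"] p \<alpha> by simp
    also have "\<dots> \<le> (\<Sum>k\<in>UNIV. max (log_ratio \<alpha> (p $ k)) 0)"
      by (intro sum_mono) simp
    finally show "F_UG x \<le> \<alpha>"
      using x \<alpha> by (simp add: F_UG_le_iff pu UG_cond_def ereal_inverse_times_ge_iff)
  qed (use F_UG_range[OF x] p in \<open>auto simp: F' geo_mean_nonneg\<close>)
qed

lemma dominates_F'_UG_F'_G: "dominates (F'_UG :: (real ^ 'k::finite) \<times> real \<Rightarrow> real) F'_G"
  unfolding dominates_def
proof
  fix x :: "(real ^ 'k) \<times> real" assume x: "x \<in> cube"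
  obtain p u where pu: "x = (p, u)"
    by (cases x)
  have "exp u * geo_mean UNIV (\<lambda>k. p $ k) \<le> exp 1 * geo_mean UNIV (\<lambda>k. p $ k)"
    using x by (intro mult_right_mono geo_mean_nonneg) (auto simp: cube_def pu)
  then show "F'_UG x \<le> F'_G x"
    using F'_UG_closed[of p u] x by (auto simp: pu F'_G_def)
qed

section \<open>The two dominated merging functions\<close>

lemma randomized_p_merging_F'_UG:
  assumes "prob_space M"
  shows "randomized_p_merging M (F'_UG :: (real ^ 'k::finite) \<times> real \<Rightarrow> real)"
proof (rule randomized_p_merging_dominated[OF assms randomized_p_merging_F_UG[OF assms] dominates_F_UG_F'_UG])
  show "F'_UG x \<in> {0..1}" if "x \<in> cube" for x :: "(real ^ 'k) \<times> real"
    using that by (cases x) (auto simp: F'_UG_closed cube_def intro!: mult_nonneg_nonneg geo_mean_nonneg)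
  show "F'_UG (p, u) \<le> F'_UG (p', u')"
    if "(p, u) \<in> cube" "(p', u') \<in> cube" "\<And>k. p $ k \<le> p' $ k" "u \<le> u'" for p p' :: "real ^ 'k" and u u'
    using that unfolding F'_UG_closed[OF that(1)] F'_UG_closed[OF that(2)]
    by (intro min.mono mult_mono geo_mean_mono geo_mean_nonneg) (auto simp: cube_def)
  \<comment> \<open>The closed formula is continuous and agrees with \<open>F'_UG\<close> on the
    cube, which is the whole space of the restricted measure.\<close>
  have "(\<lambda>x :: (real ^ 'k) \<times> real. min 1 (exp (snd x) * geo_mean UNIV (\<lambda>k. fst x $ k)))
      \<in> borel_measurable (restrict_space borel cube)"
    unfolding geo_mean_def
    by (intro borel_measurable_continuous_on_restrict continuous_intros)
  also have "?this \<longleftrightarrow> (F'_UG :: (real ^ 'k) \<times> real \<Rightarrow> real) \<in> borel_measurable (restrict_space borel cube)"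
    by (rule measurable_cong) (auto simp: space_restrict_space F'_UG_closed)
  finally show "(F'_UG :: (real ^ 'k) \<times> real \<Rightarrow> real) \<in> borel_measurable (restrict_space borel cube)" .
qed

lemma randomized_p_merging_F'_G:
  assumes "prob_space M"
  shows "randomized_p_merging M (F'_G :: (real ^ 'k::finite) \<times> real \<Rightarrow> real)"
proof (rule randomized_p_merging_dominated[OF assms randomized_p_merging_F'_UG[OF assms] dominates_F'_UG_F'_G])
  show "F'_G x \<in> {0..1}" if "x \<in> cube" for x :: "(real ^ 'k) \<times> real"
    using that by (cases x) (auto simp: F'_G_def cube_def intro!: mult_nonneg_nonneg geo_mean_nonneg)
  show "F'_G (p, u) \<le> F'_G (p', u')"
    if "(p, u) \<in> cube" "(p', u') \<in> cube" "\<And>k. p $ k \<le> p' $ k" "u \<le> u'" for p p' :: "real ^ 'k" and u u'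
    using that unfolding F'_G_def prod.case
    by (intro min.mono mult_mono geo_mean_mono geo_mean_nonneg) (auto simp: cube_def)
  show "(F'_G :: (real ^ 'k) \<times> real \<Rightarrow> real) \<in> borel_measurable (restrict_space borel cube)"
    unfolding F'_G_def case_prod_unfold geo_mean_def
    by (intro borel_measurable_continuous_on_restrict continuous_intros)
qed

section \<open>Points where the dominations are strict\<close>

lemma geo_mean_const:
  assumes "finite I" "I \<noteq> {}" "c \<ge> 0"
  shows "geo_mean I (\<lambda>_. c) = c"
  using assms by (simp add: geo_mean_def real_root_power_cancel card_gt_0_iff)

lemma strictly_dominates_F_UG_F'_UG:
  "strictly_dominates (F_UG :: (real ^ 'k::finite) \<times> real \<Rightarrow> real) F'_UG"
proof -
  \<comment> \<open>At p = (1,...,1), u = 0 the positive parts vanish and every level is admissible,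
    so \<open>F_UG\<close> is 0, while \<open>F'_UG\<close> is G(p) = 1.\<close>
  let ?x = "(\<chi> k. 1, 0) :: (real ^ 'k) \<times> real"
  have "?x \<in> cube"
    by (simp add: cube_def)
  moreover from this have "F_UG ?x < F'_UG ?x"
    by (simp add: F_UG_eq_UG_level UG_level_def F'_UG_closed geo_mean_const)
  ultimately show ?thesis
    using dominates_F_UG_F'_UG by (auto simp: strictly_dominates_def)
qed

lemma strictly_dominates_F'_UG_F'_G:
  "strictly_dominates (F'_UG :: (real ^ 'k::finite) \<times> real \<Rightarrow> real) F'_G"
proof -
  \<comment> \<open>With all components 1/e and u = 0 the values are 1/e and e * (1/e) = 1; this
    choice keeps the truncation at 1 from hiding the gap.\<close>
  let ?x = "(\<chi> k. exp (- 1), 0) :: (real ^ 'k) \<times> real"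
  have "?x \<in> cube"
    by (simp add: cube_def)
  moreover have "($) (\<chi> k. exp (- 1)) = (\<lambda>k :: 'k. exp (- 1 :: real))"
    by auto
  then have "F'_UG ?x < F'_G ?x"
    using F'_UG_closed[OF \<open>?x \<in> cube\<close>] by (simp add: F'_G_def geo_mean_const flip: exp_add)
  ultimately show ?thesis
    using dominates_F'_UG_F'_G by (auto simp: strictly_dominates_def)
qed

theorem theorem8p2:
  fixes M :: "'w measure"
  assumes "atomless_space M"
    and "CARD('k::finite) \<ge> 2"
  shows "randomized_p_merging M (F_UG :: (real ^ 'k) \<times> real \<Rightarrow> real)
      \<and> randomized_p_merging M (F'_UG :: (real ^ 'k) \<times> real \<Rightarrow> real)
      \<and> randomized_p_merging M (F'_G :: (real ^ 'k) \<times> real \<Rightarrow> real)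
      \<and> strictly_dominates (F_UG :: (real ^ 'k) \<times> real \<Rightarrow> real) F'_UG
      \<and> strictly_dominates (F'_UG :: (real ^ 'k) \<times> real \<Rightarrow> real) F'_G
      \<and> (\<forall>(p :: real ^ 'k, u) \<in> cube.
            F'_UG (p, u) = min 1 (exp u * geo_mean UNIV (\<lambda>k. p $ k)))
      \<and> (\<forall>(p :: real ^ 'k, u) \<in> cube. u > 0 \<longrightarrow>
            F_UG (p, u) = min 1 (MIN m\<in>{1..CARD('k)}.
              exp (u * real CARD('k) / real m) * geo_mean {..<m} (order_stat p)))"
proof -
  have M: "prob_space M"
    using assms by (simp add: atomless_space_def)
  have "F_UG (p, u) = min 1 (MIN m\<in>{1..CARD('k)}.
      exp (u * real CARD('k) / real m) * geo_mean {..<m} (order_stat p))"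
    if "(p, u) \<in> cube" "u > 0" for p :: "real ^ 'k" and u
    using F_UG_eq_UG_level[OF that(1)] that(2) by (simp add: UG_level_def)
  then show ?thesis
    using randomized_p_merging_F_UG[OF M] randomized_p_merging_F'_UG[OF M] randomized_p_merging_F'_G[OF M]
      strictly_dominates_F_UG_F'_UG strictly_dominates_F'_UG_F'_G F'_UG_closed
    by blast
qed

end
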